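(* Let $n\ge 2$ be an integer and let $\lambda,\mu$ be real numbers with $\frac{1}{n}<\lambda<\frac{1}{n-1}$ and $\mu<0$. Let $r(y)\in C^2(\mu,+\infty)\cap C([\mu,+\infty))$ be the unique solution of $$\left\{\begin{aligned} &\frac{r_{yy}(y)}{1+r_y(y)^2}=\frac{n-1}{r(y)}-\frac{1+r_y(y)^2}{\lambda\,(r(y)-yr_y(y))},\quad r(y)>0,\quad\text{ for all } y\in(\mu,+\infty),\\ &r(\mu)=0,\qquad r_y(\mu)=\lim_{y\searrow\mu}r_y(y)=+\infty, \end{aligned}\right.$$ which satisfies $r(y)-yr_y(y)>0$ for all $y>\mu$. Then there exist constants $y_2>y_1>0$ such that $$\left\{\begin{aligned} &r_y(y)>0\quad\text{for all }\mu<y<y_1,\\ &r_y(y_1)=0,\\ &r_y(y)<0\quad\text{for all } y>y_1, \end{aligned}\right. \qquad\qquad \left\{\begin{aligned} &r_{yy}(y)<0\quad\text{for all } \mu<y<y_2,\\ &r_{yy}(y_2)=0,\\ &r_{yy}(y)>0\quad\text{for all } y>y_2, \end{aligned}\right.$$ and moreover $$\lim_{y\to +\infty}yr_y(y)=0\qquad\text{and}\qquad \lim_{y\to +\infty}r(y)=0.$$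
   Context: Here $r$ is a real-valued function of the real variable $y$, $r_y=\frac{dr}{dy}$ and $r_{yy}=\frac{d^2r}{dy^2}$. The condition $r_y(\mu)=\lim_{y\searrow\mu}r_y(y)=+\infty$ means that the right limit of $r_y(y)$ as $y\to\mu^+$ is $+\infty$. For such $n,\lambda,\mu$ a function $r$ with the stated properties (solution of the initial value problem satisfying $r-yr_y>0$ on $(\mu,+\infty)$) exists and is unique. *)

theory Defs
  imports "HOL-Analysis.Analysis"
begin

(* Only meaningful for open S: the derivatives are two-sided and taken on the whole real line. *)
definition C2_on :: "real set \<Rightarrow> (real \<Rightarrow> real) \<Rightarrow> bool" where
  "C2_on S f \<longleftrightarrow>
     (\<forall>x\<in>S. f differentiable (at x)) \<and>
     (\<forall>x\<in>S. deriv f differentiable (at x)) \<and>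
     continuous_on S (deriv (deriv f))"

(* Solutions of the initial value problem on [\<mu>, \<infinity>).  The value of r outside this half-line is
   irrelevant.  The initial condition r_y(\<mu>) = +\<infinity> is a right limit; "deriv r \<mu>" itself is
   a junk value and is never used. *)
definition ivp_solution :: "nat \<Rightarrow> real \<Rightarrow> real \<Rightarrow> (real \<Rightarrow> real) \<Rightarrow> bool" where
  "ivp_solution n lam \<mu> r \<longleftrightarrow>
     C2_on {\<mu><..} r \<and> continuous_on {\<mu>..} r \<and>
     (\<forall>y>\<mu>. deriv (deriv r) y / (1 + (deriv r y)\<^sup>2)
              = (real n - 1) / r y - (1 + (deriv r y)\<^sup>2) / (lam * (r y - y * deriv r y))) \<and>
     (\<forall>y>\<mu>. r y > 0) \<and>
     r \<mu> = 0 \<and>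
     filterlim (deriv r) at_top (at_right \<mu>)"

end

theory Submission
  imports Defs
begin

text \<open>
  Write \<open>p\<close> for the slope \<open>r\<^sub>y\<close>, \<open>a = n - 1\<close>, \<open>b = 1 / \<lambda>\<close>, so that \<open>a < b < a + 1\<close>.  The whole
  argument consists of sign considerations for three functions, each of which can cross zero
  in one direction only.

  Clearing denominators, \<open>r\<^sub>y\<^sub>y\<close> has the sign of \<open>F = a (r - y p) - b r (1 + p\<^sup>2)\<close>.  Where \<open>p = 0\<close>
  this is \<open>(a - b) r < 0\<close>, so \<open>p\<close> vanishes at most once, going from positive to negative.  Where
  \<open>F = 0\<close>, also \<open>r\<^sub>y\<^sub>y = 0\<close> and what remains of \<open>F'\<close> is \<open>- b p (1 + p\<^sup>2)\<close>; hence \<open>F\<close> crosses zero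
  downwards where \<open>p > 0\<close> and upwards where \<open>p < 0\<close>.  Since \<open>p\<close> comes down from \<open>+\<infinity>\<close> at \<open>\<mu>\<close>, \<open>F\<close>
  is negative at points arbitrarily close to \<open>\<mu>\<close>, and therefore as long as \<open>p > 0\<close>.

  The slope cannot stay positive: for \<open>y \<ge> 0\<close> the equation would give
  \<open>r\<^sub>y\<^sub>y \<le> - (b - a) / r\<close>, which makes the energy \<open>p\<^sup>2 / 2 + (b - a) ln r\<close> nonincreasing, bounds \<open>r\<close>,
  and then drives \<open>p\<close> below zero.  This gives \<open>y\<^sub>1\<close>.  Its sign comes from \<open>G = y + r p\<close>, half the
  derivative of the squared distance \<open>y\<^sup>2 + r\<^sup>2\<close> to the origin.  It satisfies
  \<open>G' = (1 + p\<^sup>2) ((a + 1 - b) - b p G / (r - y p))\<close>, so it crosses zero upwards only, and this is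
  where \<open>\<lambda> > 1 / n\<close> enters.  If \<open>G\<close> were negative near \<open>\<mu>\<close>, then \<open>F < 0\<close> would bound \<open>r p\<close> away from
  zero there, \<open>G'\<close> would dominate a multiple of \<open>(ln r)'\<close>, and \<open>G\<close> would tend to \<open>-\<infinity>\<close> at \<open>\<mu>\<close>,
  although \<open>G > y\<close>.  So \<open>G > 0\<close> throughout, and \<open>y\<^sub>1 = G y\<^sub>1 > 0\<close>.

  Beyond \<open>y\<^sub>1\<close> the slope is negative, and a positive function cannot stay concave while decreasing;
  so \<open>F\<close> becomes zero at some \<open>y\<^sub>2\<close> and is positive from there on.  A positive, decreasing, convex
  function converges and satisfies \<open>y p \<rightarrow> 0\<close>.  Were the limit \<open>L\<close> of \<open>r\<close> positive,
  then \<open>F \<rightarrow> (a - b) L < 0\<close>, contradicting convexity.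
\<close>

section \<open>Functions that cross zero in one direction\<close>

text \<open>A function whose derivative is negative at each of its zeros cannot return to zero from below:
  at the first zero after a negative value, its values just to the left would have to be positive.\<close>

lemma stays_negative:
  fixes f f' :: "real \<Rightarrow> real"
  assumes st: "s < t"
    and der: "\<And>x. s \<le> x \<Longrightarrow> x \<le> t \<Longrightarrow> (f has_real_derivative f' x) (at x)"
    and zero: "\<And>x. s \<le> x \<Longrightarrow> x \<le> t \<Longrightarrow> f x = 0 \<Longrightarrow> f' x < 0"
    and start: "f s \<le> 0"
  shows "f t < 0"
proof (rule ccontr)
  assume "\<not> f t < 0"
  \<comment> \<open>Move off a possible zero at the left endpoint, to a point where the function is negative.\<close>
  have "\<exists>u. s \<le> u \<and> u < t \<and> f u < 0"
  proof (cases "f s = 0")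
    case True
    then have "f' s < 0" using zero[of s] st by simp
    then obtain d where "d > 0" and d: "\<forall>h>0. h < d \<longrightarrow> f s > f (s + h)"
      using DERIV_neg_dec_right[OF der[of s]] st by auto
    define h where "h = min (d / 2) ((t - s) / 2)"
    have "0 < h" "h < d" "s + h < t"
      using \<open>d > 0\<close> st by (auto simp: h_def min_def field_simps)
    then show ?thesis using d True by (intro exI[of _ "s + h"]) auto
  next
    case False
    then show ?thesis using start st by (intro exI[of _ s]) auto
  qed
  then obtain u where u: "s \<le> u" "u < t" "f u < 0" by blast
  have cont: "continuous_on {u..t} f"
    by (rule DERIV_continuous_on[of _ _ f']) (use der u in \<open>auto intro: has_field_derivative_at_within\<close>)
  define z where "z = Inf ({u..t} \<inter> f -` {0..})"
  have cl: "closed ({u..t} \<inter> f -` {0..})"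
    by (rule continuous_closed_preimage[OF cont]) auto
  have bdd: "bdd_below ({u..t} \<inter> f -` {0..})" by (intro bdd_belowI[of _ u]) auto
  have "t \<in> {u..t} \<inter> f -` {0..}" using \<open>\<not> f t < 0\<close> u by auto
  then have zin: "z \<in> {u..t} \<inter> f -` {0..}"
    unfolding z_def using closed_contains_Inf[OF _ bdd cl] by blast
  have before: "f x < 0" if "u \<le> x" "x < z" for x
  proof (rule ccontr)
    assume "\<not> f x < 0"
    then have "z \<le> x" unfolding z_def using bdd that zin by (intro cInf_lower) auto
    then show False using that by simp
  qed
  have uz: "u < z" using zin u by (cases "u = z") auto
  have "f z = 0"
  proof (rule ccontr)
    assume "f z \<noteq> 0"
    then have "f z > 0" using zin by auto
    moreover have "continuous_on {u..z} f"
      using cont zin by (auto intro: continuous_on_subset)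
    ultimately obtain x where "u \<le> x" "x \<le> z" "f x = 0"
      using IVT'[of f u 0 z] u uz by auto
    then show False using before[of x] \<open>f z > 0\<close> by (cases "x = z") auto
  qed
  then have "f' z < 0" using zero[of z] zin u by auto
  then obtain d where "d > 0" and d: "\<forall>h>0. h < d \<longrightarrow> f z < f (z - h)"
    using DERIV_neg_dec_left[OF der[of z]] zin u by auto
  define h where "h = min (d / 2) (z - u)"
  have "0 < h" "h < d" "u \<le> z - h" "z - h < z"
    using \<open>d > 0\<close> uz by (auto simp: h_def min_def)
  then show False using d \<open>f z = 0\<close> before[of "z - h"] by force
qed

section \<open>The profile equation\<close>

text \<open>Only the combinations \<open>n - 1\<close> and \<open>1 / \<lambda>\<close> enter the equation; they become the real parameters
  \<open>a\<close> and \<open>b\<close>.  The functions \<open>p\<close> and \<open>q\<close> are the first two derivatives of \<open>r\<close>.\<close>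

locale profile_curve =
  fixes a b \<mu> :: real and r p q :: "real \<Rightarrow> real"
  assumes a_pos: "0 < a" and a_less_b: "a < b" and b_less: "b < a + 1" and mu_neg: "\<mu> < 0"
    and r_deriv: "\<And>y. \<mu> < y \<Longrightarrow> (r has_real_derivative p y) (at y)"
    and p_deriv: "\<And>y. \<mu> < y \<Longrightarrow> (p has_real_derivative q y) (at y)"
    and ode: "\<And>y. \<mu> < y \<Longrightarrow>
      q y / (1 + (p y)\<^sup>2) = a / r y - b * (1 + (p y)\<^sup>2) / (r y - y * p y)"
    and r_pos: "\<And>y. \<mu> < y \<Longrightarrow> 0 < r y"
    and support_pos: "\<And>y. \<mu> < y \<Longrightarrow> 0 < r y - y * p y"
    and r_start: "(r \<longlongrightarrow> 0) (at_right \<mu>)"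
    and p_start: "filterlim p at_top (at_right \<mu>)"
begin

definition F :: "real \<Rightarrow> real" where
  "F y = a * (r y - y * p y) - b * r y * (1 + (p y)\<^sup>2)"

definition G :: "real \<Rightarrow> real" where
  "G y = y + r y * p y"

lemma b_pos: "0 < b"
  using a_pos a_less_b by simp

lemma one_plus_square_pos: "0 < 1 + (p y)\<^sup>2"
  by (simp add: add_pos_nonneg)

lemma q_eq:
  assumes "\<mu> < y"
  shows "q y = (1 + (p y)\<^sup>2) * F y / (r y * (r y - y * p y))"
proof -
  have "a / r y - b * (1 + (p y)\<^sup>2) / (r y - y * p y) = F y / (r y * (r y - y * p y))"
    using r_pos[OF assms] support_pos[OF assms] by (simp add: F_def diff_frac_eq mult_ac)
  then have "q y / (1 + (p y)\<^sup>2) = F y / (r y * (r y - y * p y))"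
    using ode[OF assms] by simp
  then show ?thesis
    using one_plus_square_pos[of y] by (simp add: divide_eq_eq mult_ac)
qed

lemma q_sign:
  assumes "\<mu> < y"
  shows "q y < 0 \<longleftrightarrow> F y < 0" "q y = 0 \<longleftrightarrow> F y = 0" "0 < q y \<longleftrightarrow> 0 < F y"
proof -
  define c where "c = (1 + (p y)\<^sup>2) / (r y * (r y - y * p y))"
  have "0 < c"
    unfolding c_def using r_pos[OF assms] support_pos[OF assms] one_plus_square_pos[of y] by simp
  moreover have "q y = c * F y" using q_eq[OF assms] by (simp add: c_def)
  ultimately show "q y < 0 \<longleftrightarrow> F y < 0" "q y = 0 \<longleftrightarrow> F y = 0" "0 < q y \<longleftrightarrow> 0 < F y"
    by (auto simp: mult_less_0_iff zero_less_mult_iff)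
qed

lemma F_neg_if_p_zero:
  assumes "\<mu> < y" "p y = 0"
  shows "F y < 0"
proof -
  have "F y = (a - b) * r y" using assms by (simp add: F_def algebra_simps)
  then show ?thesis using r_pos[OF assms(1)] a_less_b by (simp add: mult_neg_pos)
qed

lemma F_deriv:
  assumes "\<mu> < y"
  shows "(F has_real_derivative
    (- (a * y + 2 * b * r y * p y) * q y - b * p y * (1 + (p y)\<^sup>2))) (at y)"
  unfolding F_def[abs_def]
  by (rule derivative_eq_intros r_deriv[OF assms] p_deriv[OF assms] refl)+
    (simp add: algebra_simps power2_eq_square)

text \<open>With \<open>Q = r - y p\<close>, the identity \<open>r (1 + p\<^sup>2) = Q + p G\<close> turns
  \<open>G' = 1 + p\<^sup>2 + r r\<^sub>y\<^sub>y\<close> into a linear first-order equation for \<open>G\<close> with positive forcing term.\<close>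

lemma G_deriv:
  assumes "\<mu> < y"
  shows "(G has_real_derivative
    ((1 + (p y)\<^sup>2) * ((a + 1 - b) - b * p y * G y / (r y - y * p y)))) (at y)"
proof -
  have rq: "r y * q y = (1 + (p y)\<^sup>2) * F y / (r y - y * p y)"
    using q_eq[OF assms] r_pos[OF assms] by simp
  have "F y = (a - b) * (r y - y * p y) - b * p y * G y"
    by (simp add: F_def G_def algebra_simps power2_eq_square)
  then have "F y / (r y - y * p y) = a - b - b * p y * G y / (r y - y * p y)"
    using support_pos[OF assms] by (simp add: diff_divide_distrib)
  then have "r y * q y = (1 + (p y)\<^sup>2) * (a - b - b * p y * G y / (r y - y * p y))"
    using rq by (metis times_divide_eq_right)
  moreover have "(G has_real_derivative (1 + (p y)\<^sup>2 + r y * q y)) (at y)"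
    unfolding G_def[abs_def]
    by (rule derivative_eq_intros r_deriv[OF assms] p_deriv[OF assms] refl)+
      (simp add: power2_eq_square)
  moreover have "1 + (p y)\<^sup>2 + (1 + (p y)\<^sup>2) * (a - b - X) = (1 + (p y)\<^sup>2) * ((a + 1 - b) - X)" for X
    by (simp add: algebra_simps)
  ultimately show ?thesis by simp
qed

lemma p_stays_negative:
  assumes "\<mu> < s" "s < t" "p s \<le> 0"
  shows "p t < 0"
proof (rule stays_negative[of s t p q])
  fix x assume x: "s \<le> x" "x \<le> t"
  show "(p has_real_derivative q x) (at x)" using x assms by (intro p_deriv) auto
  show "q x < 0" if "p x = 0" using F_neg_if_p_zero that q_sign(1) x assms by auto
qed (use assms in auto)

section \<open>Behaviour near the starting point\<close>

text \<open>If \<open>r\<close> were convex on an interval starting at \<open>\<mu>\<close>, its slope would be bounded above there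
  instead of tending to \<open>+\<infinity>\<close>.\<close>

lemma F_neg_near_start:
  assumes "\<mu> < y"
  shows "\<exists>s. \<mu> < s \<and> s < y \<and> F s < 0"
proof (rule ccontr)
  assume "\<not> ?thesis"
  then have conv: "0 \<le> q x" if "\<mu> < x" "x < y" for x
    using that q_sign(1)[of x] by (meson not_le)
  define m where "m = (\<mu> + y) / 2"
  have m: "\<mu> < m" "m < y" using assms by (auto simp: m_def)
  have "eventually (\<lambda>x. p m + 1 \<le> p x) (at_right \<mu>)"
    using p_start by (simp add: filterlim_at_top)
  moreover have "eventually (\<lambda>x. x \<in> {\<mu><..<m}) (at_right \<mu>)"
    using m by (simp add: eventually_at_right_field) blast
  ultimately have "eventually (\<lambda>x. p m + 1 \<le> p x \<and> x \<in> {\<mu><..<m}) (at_right \<mu>)"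
    by eventually_elim simp
  then obtain x where x: "p m + 1 \<le> p x" "\<mu> < x" "x < m"
    using eventually_happens'[OF trivial_limit_at_right_real] by auto
  have "p x \<le> p m"
  proof (rule DERIV_nonneg_imp_nondecreasing[of x m])
    fix u assume "x \<le> u" "u \<le> m"
    then show "\<exists>y. (p has_real_derivative y) (at u) \<and> 0 \<le> y"
      using x m conv p_deriv by (intro exI[of _ "q u"]) auto
  qed (use x in simp)
  then show False using x by simp
qed

lemma F_neg_while_p_pos:
  assumes "\<mu> < y" and pos: "\<And>x. \<mu> < x \<Longrightarrow> x \<le> y \<Longrightarrow> 0 < p x"
  shows "F y < 0"
proof -
  obtain s where s: "\<mu> < s" "s < y" "F s < 0" using F_neg_near_start[OF assms(1)] by blast
  show ?thesis
  proof (rule stays_negative[OF s(2)])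
    fix x assume x: "s \<le> x" "x \<le> y"
    then have "\<mu> < x" using s by simp
    show "(F has_real_derivative
        (- (a * x + 2 * b * r x * p x) * q x - b * p x * (1 + (p x)\<^sup>2))) (at x)"
      using F_deriv[OF \<open>\<mu> < x\<close>] .
    show "- (a * x + 2 * b * r x * p x) * q x - b * p x * (1 + (p x)\<^sup>2) < 0" if "F x = 0"
    proof -
      have "q x = 0" using that q_sign(2)[OF \<open>\<mu> < x\<close>] by simp
      moreover have "0 < b * p x * (1 + (p x)\<^sup>2)"
        using b_pos pos[OF \<open>\<mu> < x\<close>] x one_plus_square_pos[of x] by simp
      ultimately show ?thesis by simp
    qed
  qed (use s in simp)
qed

text \<open>Where \<open>p \<ge> 1\<close>, \<open>F < 0\<close> forces \<open>r p \<ge> \<epsilon>\<close> for a constant \<open>\<epsilon>\<close> of the order of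
  \<open>- \<mu>\<close>.  If \<open>G < 0\<close>, both summands of \<open>G'\<close> are nonnegative, so \<open>G' \<ge> k p\<^sup>2 \<ge> k \<epsilon> p / r\<close> with
  \<open>k = a + 1 - b\<close>.  Thus \<open>G - k \<epsilon> ln r\<close> is nondecreasing, and as \<open>r \<rightarrow> 0\<close> at \<open>\<mu>\<close> this would push
  \<open>G\<close> to \<open>-\<infinity>\<close>, below its lower bound \<open>\<mu>\<close>.\<close>

lemma G_nonneg_near_start:
  assumes "\<mu> < c"
  shows "\<exists>s. \<mu> < s \<and> s < c \<and> 0 \<le> G s"
proof (rule ccontr)
  assume "\<not> ?thesis"
  then have Gneg: "G x < 0" if "\<mu> < x" "x < c" for x using that by (meson not_le)
  have "eventually (\<lambda>x. 1 \<le> p x) (at_right \<mu>)"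
    using p_start by (simp add: filterlim_at_top)
  then obtain d where d: "\<mu> < d" "\<And>x. \<mu> < x \<Longrightarrow> x < d \<Longrightarrow> 1 \<le> p x"
    by (auto simp: eventually_at_right_field)
  \<comment> \<open>The bound \<open>\<mu> / 2\<close> keeps \<open>- y\<close>, and with it \<open>r - y p \<ge> (- \<mu> / 2) p\<close>, away from zero.\<close>
  define e where "e = min (min c d) (\<mu> / 2)"
  have e: "\<mu> < e" "e \<le> c" "e \<le> d" "e \<le> \<mu> / 2" using assms d mu_neg by (auto simp: e_def)
  define \<epsilon> where "\<epsilon> = a * (- \<mu>) / (4 * b)"
  define k where "k = a + 1 - b"
  have eps: "0 < \<epsilon>" unfolding \<epsilon>_def by (intro divide_pos_pos mult_pos_pos) (use a_pos b_pos mu_neg in auto)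
  have k: "0 < k" using b_less by (simp add: k_def)
  have p1: "1 \<le> p x" if "\<mu> < x" "x < e" for x using d(2)[of x] that e by simp
  have w: "\<epsilon> \<le> r x * p x" if x: "\<mu> < x" "x < e" for x
  proof -
    note p1[OF x]
    have "F x < 0"
    proof (rule F_neg_while_p_pos[OF x(1)])
      fix z assume "\<mu> < z" "z \<le> x"
      then show "0 < p z" using p1[of z] x by simp
    qed
    then have "a * (r x - x * p x) < b * r x * (1 + (p x)\<^sup>2)" by (simp add: F_def)
    moreover have "b * r x * (1 + (p x)\<^sup>2) \<le> b * r x * (2 * (p x)\<^sup>2)"
      using p1[OF x] b_pos r_pos[OF x(1)] by (intro mult_left_mono) (auto simp: one_le_power)
    moreover have "a * ((- \<mu> / 2) * p x) \<le> a * (r x - x * p x)"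
    proof (intro mult_left_mono)
      have "(- \<mu> / 2) * p x \<le> (- x) * p x" using p1[OF x] x e by (intro mult_right_mono) auto
      then show "(- \<mu> / 2) * p x \<le> r x - x * p x" using r_pos[OF x(1)] by simp
    qed (use a_pos in simp)
    ultimately have "(a * (- \<mu> / 2)) * p x \<le> (2 * b * (r x * p x)) * p x"
      by (simp add: power2_eq_square algebra_simps)
    then have "a * (- \<mu> / 2) \<le> 2 * b * (r x * p x)"
      using p1[OF x] by (auto simp only: mult_le_cancel_right)
    then show ?thesis using b_pos unfolding \<epsilon>_def by (subst pos_divide_le_eq) (auto simp: mult_ac)
  qed
  define H where "H = (\<lambda>x. G x - k * \<epsilon> * ln (r x))"
  define m where "m = (\<mu> + e) / 2"
  have m: "\<mu> < m" "m < e" using e by (auto simp: m_def)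
  have Hmono: "H x \<le> H m" if x: "\<mu> < x" "x \<le> m" for x
  proof (rule DERIV_nonneg_imp_nondecreasing[OF x(2)])
    fix z assume z: "x \<le> z" "z \<le> m"
    then have mz: "\<mu> < z" and ze: "z < e" using x m by auto
    let ?D = "(1 + (p z)\<^sup>2) * (k - b * p z * G z / (r z - z * p z))"
    have "(H has_real_derivative ?D - k * \<epsilon> * (p z / r z)) (at z)"
      unfolding H_def
      by (rule derivative_eq_intros G_deriv[OF mz] r_deriv[OF mz] refl)+
        (use r_pos[OF mz] r_deriv[OF mz] in \<open>auto simp: k_def\<close>)
    moreover have "k * \<epsilon> * (p z / r z) \<le> ?D"
    proof -
      have "\<epsilon> * (p z / r z) \<le> (r z * p z) * (p z / r z)"
        using w[OF mz ze] p1[OF mz ze] r_pos[OF mz] by (intro mult_right_mono) auto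
      also have "\<dots> = (p z)\<^sup>2" using r_pos[OF mz] by (simp add: power2_eq_square)
      finally have "k * (\<epsilon> * (p z / r z)) \<le> k * (1 + (p z)\<^sup>2)"
        using k by (intro mult_left_mono) auto
      also have "\<dots> \<le> ?D"
      proof -
        have "b * p z * G z / (r z - z * p z) \<le> 0"
          using b_pos p1[OF mz ze] Gneg[OF mz] ze e support_pos[OF mz]
          by (intro divide_nonpos_pos mult_nonneg_nonpos) auto
        then have "(1 + (p z)\<^sup>2) * k \<le> ?D" by (intro mult_left_mono) auto
        then show ?thesis by (simp add: mult.commute)
      qed
      finally show ?thesis by (simp add: mult.assoc)
    qed
    ultimately show "\<exists>D. (H has_real_derivative D) (at z) \<and> 0 \<le> D" by force
  qed
  have "filterlim r (at_right 0) (at_right \<mu>)"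
  proof (rule tendsto_imp_filterlim_at_right[OF r_start])
    show "eventually (\<lambda>x. 0 < r x) (at_right \<mu>)"
      using eventually_at_right_less[of \<mu>] by eventually_elim (rule r_pos)
  qed
  then have "filterlim (\<lambda>x. ln (r x)) at_bot (at_right \<mu>)"
    by (rule filterlim_compose[OF ln_at_0])
  then have "eventually (\<lambda>x. ln (r x) \<le> (\<mu> - H m) / (k * \<epsilon>)) (at_right \<mu>)"
    by (simp add: filterlim_at_bot)
  moreover have "eventually (\<lambda>x. x \<in> {\<mu><..<m}) (at_right \<mu>)"
    using m by (simp add: eventually_at_right_field) blast
  ultimately have "eventually (\<lambda>x. ln (r x) \<le> (\<mu> - H m) / (k * \<epsilon>) \<and> x \<in> {\<mu><..<m}) (at_right \<mu>)"
    by eventually_elim simp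
  then obtain x where x: "ln (r x) \<le> (\<mu> - H m) / (k * \<epsilon>)" "\<mu> < x" "x < m"
    using eventually_happens'[OF trivial_limit_at_right_real] by auto
  have "k * \<epsilon> * ln (r x) \<le> \<mu> - H m" using x(1) k eps by (simp add: le_divide_eq mult_ac)
  then have "G x \<le> \<mu>" using Hmono[of x] x by (simp add: H_def)
  moreover have "0 < r x * p x" using w[of x] x m eps by simp
  ultimately show False using x by (simp add: G_def)
qed

lemma G_pos:
  assumes "\<mu> < y"
  shows "0 < G y"
proof -
  obtain s where s: "\<mu> < s" "s < y" "0 \<le> G s" using G_nonneg_near_start[OF assms] by blast
  have "- G y < 0"
  proof (rule stays_negative[OF s(2)])
    fix x assume x: "s \<le> x" "x \<le> y"
    then have "\<mu> < x" using s by simp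
    let ?D = "(1 + (p x)\<^sup>2) * ((a + 1 - b) - b * p x * G x / (r x - x * p x))"
    show "((\<lambda>y. - G y) has_real_derivative - ?D) (at x)"
      using DERIV_minus[OF G_deriv[OF \<open>\<mu> < x\<close>]] .
    show "- ?D < 0" if "- G x = 0"
      using that b_less one_plus_square_pos[of x] by simp
  qed (use s in simp)
  then show ?thesis by simp
qed

section \<open>The maximum and the inflection point\<close>

text \<open>For \<open>y \<ge> 0\<close> and \<open>p > 0\<close>, \<open>r - y p \<le> r\<close>, hence \<open>F\<close> is at most
  \<open>(a - b) (r - y p)\<close>, and the factor \<open>1 + p\<^sup>2 \<ge> 1\<close> in \<open>r\<^sub>y\<^sub>y\<close> can only enlarge this negative number in
  absolute value.\<close>

lemma q_upper_bound:
  assumes "0 \<le> y" "0 < p y"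
  shows "q y \<le> - ((b - a) / r y)"
proof -
  have my: "\<mu> < y" using assms mu_neg by simp
  let ?s = "1 + (p y)\<^sup>2" and ?Q = "r y - y * p y"
  have s: "1 \<le> ?s" by simp
  have Q: "0 < ?Q" "?Q \<le> r y" using support_pos[OF my] assms by auto
  have "F y \<le> (a - b) * ?Q"
  proof -
    have "b * ?Q \<le> b * (r y * ?s)"
    proof (intro mult_left_mono)
      show "?Q \<le> r y * ?s" using Q(2) mult_left_mono[OF s, of "r y"] r_pos[OF my] by linarith
    qed (use b_pos in simp)
    then show ?thesis by (simp add: F_def algebra_simps)
  qed
  then have "F y / (r y * ?Q) \<le> (a - b) * ?Q / (r y * ?Q)"
    using Q r_pos[OF my] by (intro divide_right_mono) auto
  also have "\<dots> = (a - b) / r y" using Q by simp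
  finally have *: "F y / (r y * ?Q) \<le> (a - b) / r y" .
  have neg: "(a - b) / r y < 0" using a_less_b r_pos[OF my] by (simp add: divide_neg_pos)
  have "q y = ?s * (F y / (r y * ?Q))" using q_eq[OF my] by simp
  also have "\<dots> \<le> ?s * ((a - b) / r y)" using * by (intro mult_left_mono) auto
  also have "\<dots> \<le> 1 * ((a - b) / r y)" using neg s by (intro mult_right_mono_neg) auto
  also have "\<dots> = - ((b - a) / r y)" by (simp add: diff_divide_distrib)
  finally show ?thesis .
qed

text \<open>Multiplying the bound on \<open>r\<^sub>y\<^sub>y\<close> by \<open>p\<close> shows that the energy \<open>E\<close> is nonincreasing,
  so \<open>ln r\<close> is bounded and \<open>r\<^sub>y\<^sub>y\<close> is bounded away from zero.\<close>

lemma p_not_always_pos: "\<exists>z>\<mu>. p z \<le> 0"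
proof (rule ccontr)
  assume "\<not> ?thesis"
  then have pp: "0 < p z" if "\<mu> < z" for z using that by (meson not_le)
  define E where "E = (\<lambda>y. (p y)\<^sup>2 / 2 + (b - a) * ln (r y))"
  have E: "E y \<le> E 0" if "0 \<le> y" for y
  proof (rule DERIV_nonpos_imp_nonincreasing[OF that])
    fix z assume z: "0 \<le> z" "z \<le> y"
    then have mz: "\<mu> < z" using mu_neg by simp
    have "(E has_real_derivative p z * q z + (b - a) * (p z / r z)) (at z)"
      unfolding E_def
      by (rule derivative_eq_intros p_deriv[OF mz] r_deriv[OF mz] refl)+
        (use r_pos[OF mz] in \<open>auto intro!: derivative_eq_intros r_deriv[OF mz]\<close>)
    moreover have "p z * (- ((b - a) / r z)) = - ((b - a) * (p z / r z))"
      by (simp only: times_divide_eq_right mult_minus_right mult.commute)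
    moreover have "p z * q z \<le> p z * (- ((b - a) / r z))"
      using q_upper_bound[OF z(1)] pp[OF mz] by (intro mult_left_mono) auto
    ultimately show "\<exists>D. (E has_real_derivative D) (at z) \<and> D \<le> 0"
      by (intro exI[of _ "p z * q z + (b - a) * (p z / r z)"] conjI) linarith+
  qed
  define M where "M = exp (E 0 / (b - a))"
  have rM: "r y \<le> M" if "0 \<le> y" for y
  proof -
    have my: "\<mu> < y" using that mu_neg by simp
    have "(b - a) * ln (r y) \<le> E 0" using E[OF that] zero_le_power2[of "p y"] unfolding E_def by linarith
    then have "ln (r y) \<le> E 0 / (b - a)" using a_less_b by (simp add: le_divide_eq mult.commute)
    then show ?thesis unfolding M_def using r_pos[OF my] by (simp add: ln_ge_iff flip: ln_le_cancel_iff)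
  qed
  have "0 < M" by (simp add: M_def)
  define c where "c = (b - a) / M"
  have "0 < c" using a_less_b \<open>0 < M\<close> by (simp add: c_def)
  have qc: "q y \<le> - c" if "0 \<le> y" for y
  proof -
    have my: "\<mu> < y" using that mu_neg by simp
    have "c \<le> (b - a) / r y"
      unfolding c_def using rM[OF that] r_pos[OF my] a_less_b by (intro divide_left_mono) auto
    then show ?thesis using q_upper_bound[OF that pp[OF my]] by linarith
  qed
  \<comment> \<open>The time at which a slope starting at \<open>p 0\<close> and falling at rate \<open>c\<close> has dropped to zero.\<close>
  define T where "T = p 0 / c"
  have "0 \<le> T" using pp[of 0] mu_neg \<open>0 < c\<close> by (simp add: T_def)
  have "p T + c * T \<le> p 0 + c * 0"
  proof (rule DERIV_nonpos_imp_nonincreasing[OF \<open>0 \<le> T\<close>, where f = "\<lambda>y. p y + c * y"])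
    fix z assume z: "0 \<le> z" "z \<le> T"
    then have mz: "\<mu> < z" using mu_neg by simp
    have "((\<lambda>y. p y + c * y) has_real_derivative q z + c) (at z)"
      by (rule derivative_eq_intros p_deriv[OF mz] refl)+ simp
    then show "\<exists>D. ((\<lambda>y. p y + c * y) has_real_derivative D) (at z) \<and> D \<le> 0"
      using qc[OF z(1)] by force
  qed
  then have "p T \<le> 0" using \<open>0 < c\<close> by (simp add: T_def)
  then show False using pp[of T] \<open>0 \<le> T\<close> mu_neg by simp
qed

lemma continuous_on_p: "\<mu> < s \<Longrightarrow> continuous_on {s..t} p"
  by (rule DERIV_continuous_on[of _ _ q]) (auto intro!: has_field_derivative_at_within p_deriv)

lemma ex_maximum:
  "\<exists>y1>0. p y1 = 0 \<and> (\<forall>y. \<mu> < y \<and> y < y1 \<longrightarrow> 0 < p y) \<and> (\<forall>y>y1. p y < 0)"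
proof -
  obtain z where z: "\<mu> < z" "p z \<le> 0" using p_not_always_pos by blast
  have p0: "0 < p 0"
  proof -
    have "0 < r 0 * p 0" using G_pos[of 0] mu_neg by (simp add: G_def)
    then show ?thesis using r_pos[of 0] mu_neg by (simp add: zero_less_mult_iff)
  qed
  have "0 < z"
  proof (rule ccontr)
    assume "\<not> 0 < z"
    then show False using p_stays_negative[of z 0] z p0 by (cases "z = 0") auto
  qed
  then obtain y1 where y1: "0 \<le> y1" "y1 \<le> z" "p y1 = 0"
    using IVT2'[of p z 0 0] z p0 continuous_on_p[of 0 z] mu_neg by auto
  have "0 < y1" using y1 p0 by (cases "y1 = 0") auto
  moreover have "0 < p y" if "\<mu> < y" "y < y1" for y
    using p_stays_negative[of y y1] that y1 by force
  moreover have "p y < 0" if "y1 < y" for y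
    using p_stays_negative[of y1 y] that y1 mu_neg by simp
  ultimately show ?thesis using y1(3) by blast
qed

lemma ex_inflection:
  assumes y1: "\<mu> < y1" "p y1 = 0" and before: "\<And>y. \<mu> < y \<Longrightarrow> y < y1 \<Longrightarrow> 0 < p y"
    and after: "\<And>y. y1 < y \<Longrightarrow> p y < 0"
  shows "\<exists>y2>y1. F y2 = 0 \<and> (\<forall>y. \<mu> < y \<and> y < y2 \<longrightarrow> F y < 0) \<and> (\<forall>y>y2. 0 < F y)"
proof -
  have F1: "F y1 < 0" using F_neg_if_p_zero y1 by simp
  \<comment> \<open>Otherwise \<open>r\<close> lies below its tangent line at \<open>y\<^sub>1 + 1\<close>, which has negative slope.\<close>
  have "\<exists>z>y1. 0 \<le> F z"
  proof (rule ccontr)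
    assume "\<not> ?thesis"
    then have Fn: "F z < 0" if "y1 < z" for z using that by (meson not_le)
    define s where "s = y1 + 1"
    have s: "y1 < s" "\<mu> < s" using y1 by (auto simp: s_def)
    have ps: "p s < 0" using after s by simp
    have pz: "p z \<le> p s" if "s \<le> z" for z
    proof (rule DERIV_nonpos_imp_nonincreasing[OF that])
      fix x assume "s \<le> x" "x \<le> z"
      then show "\<exists>D. (p has_real_derivative D) (at x) \<and> D \<le> 0"
        using p_deriv[of x] q_sign(1)[of x] Fn[of x] s by (intro exI[of _ "q x"]) auto
    qed
    \<comment> \<open>The zero of that tangent line.\<close>
    define T where "T = s + r s / (- p s)"
    have sT: "s \<le> T" using r_pos[OF s(2)] ps by (simp add: T_def divide_nonneg_neg)
    have "r T - p s * T \<le> r s - p s * s"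
    proof (rule DERIV_nonpos_imp_nonincreasing[OF sT, where f = "\<lambda>y. r y - p s * y"])
      fix x assume x: "s \<le> x" "x \<le> T"
      then have mx: "\<mu> < x" using s by simp
      have "((\<lambda>y. r y - p s * y) has_real_derivative p x - p s) (at x)"
        by (rule derivative_eq_intros r_deriv[OF mx] refl)+ simp
      then show "\<exists>D. ((\<lambda>y. r y - p s * y) has_real_derivative D) (at x) \<and> D \<le> 0"
        using pz[OF x(1)] by force
    qed
    then have "r T \<le> 0" using ps by (simp add: ring_distribs T_def)
    then show False using r_pos[of T] sT s by simp
  qed
  then obtain z where z: "y1 < z" "0 \<le> F z" by blast
  have "continuous_on {y1..z} F"
  proof (rule DERIV_continuous_on)
    fix x assume "x \<in> {y1..z}"
    then have "\<mu> < x" using y1 by simp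
    then show "(F has_real_derivative
        (- (a * x + 2 * b * r x * p x) * q x - b * p x * (1 + (p x)\<^sup>2))) (at x within {y1..z})"
      by (rule has_field_derivative_at_within[OF F_deriv])
  qed
  then obtain y2 where y2: "y1 \<le> y2" "y2 \<le> z" "F y2 = 0"
    using IVT'[of F y1 0 z] F1 z by auto
  have y12: "y1 < y2" using y2 F1 by (cases "y1 = y2") auto
  have up: "0 < F t" if s: "y1 < s" "s < t" "0 \<le> F s" for s t
  proof -
    have "- F t < 0"
    proof (rule stays_negative[OF s(2)])
      fix x assume x: "s \<le> x" "x \<le> t"
      then have mx: "\<mu> < x" and px: "p x < 0" using s y1 after[of x] by auto
      let ?D = "- (a * x + 2 * b * r x * p x) * q x - b * p x * (1 + (p x)\<^sup>2)"
      show "((\<lambda>y. - F y) has_real_derivative - ?D) (at x)"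
        using DERIV_minus[OF F_deriv[OF mx]] .
      show "- ?D < 0" if "- F x = 0"
      proof -
        have "q x = 0" using that q_sign(2)[OF mx] by simp
        moreover have "b * p x * (1 + (p x)\<^sup>2) < 0"
          using b_pos px one_plus_square_pos[of x] by (simp add: mult_pos_neg mult_neg_pos)
        ultimately show ?thesis by simp
      qed
    qed (use s in simp)
    then show ?thesis by simp
  qed
  have "F y < 0" if y: "\<mu> < y" "y < y2" for y
  proof (cases "y < y1")
    case True
    then show ?thesis using before by (intro F_neg_while_p_pos[OF y(1)]) simp
  next
    case False
    then consider "y = y1" | "y1 < y" by linarith
    then show ?thesis
    proof cases
      case 1
      then show ?thesis using F1 by simp
    next
      case 2
      then show ?thesis using up[of y y2] y(2) y2(3) by (cases "0 \<le> F y") simp_all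
    qed
  qed
  moreover have "\<forall>y>y2. 0 < F y" using up[OF y12] y2(3) by simp
  ultimately show ?thesis using y12 y2(3) by blast
qed

section \<open>Behaviour at infinity\<close>

text \<open>By convexity, \<open>- (y / 2) p(y) \<le> r(y / 2) - r(y)\<close>, and the right-hand side
  tends to zero because \<open>r\<close> converges.\<close>

lemma limits_at_infinity:
  assumes y2: "0 < y2" and dec: "\<And>y. y2 < y \<Longrightarrow> p y < 0" and conv: "\<And>y. y2 < y \<Longrightarrow> 0 < F y"
  shows "((\<lambda>y. y * p y) \<longlongrightarrow> 0) at_top" "(r \<longlongrightarrow> 0) at_top"
proof -
  have mu2: "\<mu> < y" if "y2 < y" for y using that y2 mu_neg by simp
  have r_anti: "r t \<le> r s" if "y2 < s" "s \<le> t" for s t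
  proof (rule DERIV_nonpos_imp_nonincreasing[OF that(2)])
    fix x assume "s \<le> x" "x \<le> t"
    then show "\<exists>D. (r has_real_derivative D) (at x) \<and> D \<le> 0"
      using r_deriv[of x] mu2[of x] dec[of x] that by (intro exI[of _ "p x"]) auto
  qed
  have p_mono: "p s \<le> p t" if "y2 < s" "s \<le> t" for s t
  proof (rule DERIV_nonneg_imp_nondecreasing[OF that(2)])
    fix x assume "s \<le> x" "x \<le> t"
    then show "\<exists>D. (p has_real_derivative D) (at x) \<and> 0 \<le> D"
      using p_deriv[of x] mu2[of x] conv[of x] q_sign(3)[of x] that
      by (intro exI[of _ "q x"]) auto
  qed
  define L where "L = Inf (r ` {y2<..})"
  have bdd: "bdd_below (r ` {y2<..})"
    using r_pos mu2 by (intro bdd_belowI[of _ 0]) (auto intro: less_imp_le)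
  have rL: "L \<le> r y" if "y2 < y" for y unfolding L_def using that bdd by (intro cInf_lower) auto
  have L0: "0 \<le> L" unfolding L_def
  proof (rule cInf_greatest)
    show "r ` {y2<..} \<noteq> {}" by auto
  qed (use r_pos mu2 in \<open>auto intro: less_imp_le\<close>)
  have r_lim: "(r \<longlongrightarrow> L) at_top"
  proof (rule order_tendstoI)
    fix l assume "l < L"
    show "eventually (\<lambda>y. l < r y) at_top"
      using eventually_gt_at_top[of y2] by eventually_elim (use rL \<open>l < L\<close> in force)
  next
    fix l assume "L < l"
    then obtain s where s: "y2 < s" "r s < l"
      unfolding L_def using cInf_lessD[of "r ` {y2<..}" l] by auto
    show "eventually (\<lambda>y. r y < l) at_top"
      using eventually_ge_at_top[of s] by eventually_elim (use r_anti s in force)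
  qed
  have half: "(r y - r (y / 2)) * 2 \<le> y * p y" if y: "2 * y2 < y" for y
  proof -
    have le: "y / 2 \<le> y" using y y2 by simp
    have "r y - p y * y \<le> r (y / 2) - p y * (y / 2)"
    proof (rule DERIV_nonpos_imp_nonincreasing[OF le, where f = "\<lambda>x. r x - p y * x"])
      fix x assume x: "y / 2 \<le> x" "x \<le> y"
      then have x2: "y2 < x" using y by simp
      have "((\<lambda>x. r x - p y * x) has_real_derivative p x - p y) (at x)"
        by (rule derivative_eq_intros r_deriv[OF mu2[OF x2]] refl)+ simp
      then show "\<exists>D. ((\<lambda>x. r x - p y * x) has_real_derivative D) (at x) \<and> D \<le> 0"
        using p_mono[OF x2 x(2)] by force
    qed
    then show ?thesis by (simp add: algebra_simps)
  qed
  have "filterlim (\<lambda>y::real. y / 2) at_top at_top"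
    by (rule filterlim_at_top_mult_tendsto_pos[of "\<lambda>_. 1/2" "1/2", simplified]) 
      (auto simp: filterlim_ident)
  then have "((\<lambda>y. r (y / 2)) \<longlongrightarrow> L) at_top" by (rule filterlim_compose[OF r_lim])
  from tendsto_mult[OF tendsto_diff[OF r_lim this] tendsto_const[of 2]]
  have low: "((\<lambda>y. (r y - r (y / 2)) * 2) \<longlongrightarrow> 0) at_top" by simp
  show yp: "((\<lambda>y. y * p y) \<longlongrightarrow> 0) at_top"
  proof (rule tendsto_sandwich[OF _ _ low tendsto_const])
    show "eventually (\<lambda>y. (r y - r (y / 2)) * 2 \<le> y * p y) at_top"
      using eventually_gt_at_top[of "2 * y2"] by eventually_elim (rule half)
    show "eventually (\<lambda>y. y * p y \<le> 0) at_top"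
      using eventually_gt_at_top[of y2]
      by eventually_elim (use dec y2 in \<open>force intro: mult_nonneg_nonpos less_imp_le\<close>)
  qed
  have p_lim: "(p \<longlongrightarrow> 0) at_top"
  proof -
    have "((\<lambda>y. inverse y * (y * p y)) \<longlongrightarrow> 0 * 0) at_top"
      by (intro tendsto_mult yp tendsto_inverse_0_at_top filterlim_ident)
    moreover have "eventually (\<lambda>y. inverse y * (y * p y) = p y) at_top"
      using eventually_gt_at_top[of 0] by eventually_elim simp
    ultimately show ?thesis by (simp cong: filterlim_cong add: tendsto_cong)
  qed
  have "(F \<longlongrightarrow> a * (L - 0) - b * L * (1 + 0\<^sup>2)) at_top"
    unfolding F_def[abs_def] by (intro tendsto_intros r_lim yp p_lim)
  moreover have "eventually (\<lambda>y. 0 \<le> F y) at_top"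
    using eventually_gt_at_top[of y2] by eventually_elim (use conv in force)
  ultimately have "0 \<le> a * (L - 0) - b * L * (1 + 0\<^sup>2)"
    by (intro tendsto_lowerbound) auto
  then have "0 \<le> (a - b) * L" by (simp add: algebra_simps)
  then have "L = 0" using a_less_b L0 by (simp add: zero_le_mult_iff)
  then show "(r \<longlongrightarrow> 0) at_top" using r_lim by simp
qed

end

section \<open>Solutions of the initial value problem\<close>

lemma profile_curve_of_ivp_solution:
  assumes "2 \<le> n" "1 / real n < lam" "lam < 1 / (real n - 1)" "\<mu> < 0"
    and sol: "ivp_solution n lam \<mu> r" and "\<forall>y>\<mu>. r y - y * deriv r y > 0"
  shows "profile_curve (real n - 1) (1 / lam) \<mu> r (deriv r) (deriv (deriv r))"
proof
  have lam: "0 < lam" using assms(1,2) by (smt (verit) divide_nonneg_nonneg of_nat_0_le_iff)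
  show "0 < real n - 1" "\<mu> < 0" using assms by auto
  show "real n - 1 < 1 / lam" "1 / lam < real n - 1 + 1"
    using assms(1-3) lam by (auto simp: field_simps)
  show "filterlim (deriv r) at_top (at_right \<mu>)" using sol by (simp add: ivp_solution_def)
  have "continuous_on {\<mu>..} r" "r \<mu> = 0" using sol by (auto simp: ivp_solution_def)
  then have "(r \<longlongrightarrow> 0) (at \<mu> within {\<mu>..})" by (metis atLeast_iff continuous_on_def order_refl)
  then show "(r \<longlongrightarrow> 0) (at_right \<mu>)" by (rule tendsto_within_subset) auto
next
  fix y assume y: "\<mu> < y"
  show "(r has_real_derivative deriv r y) (at y)"
    "(deriv r has_real_derivative deriv (deriv r) y) (at y)"
    using sol y by (auto simp: ivp_solution_def C2_on_def DERIV_deriv_iff_real_differentiable)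
  show "0 < r y" using sol y by (simp add: ivp_solution_def)
  show "0 < r y - y * deriv r y" using assms(6) y by blast
  show "deriv (deriv r) y / (1 + (deriv r y)\<^sup>2)
      = (real n - 1) / r y - 1 / lam * (1 + (deriv r y)\<^sup>2) / (r y - y * deriv r y)"
    using sol y by (simp add: ivp_solution_def)
qed

theorem theorem1p2:
  fixes n :: nat and lam \<mu> :: real and r :: "real \<Rightarrow> real"
  assumes "n \<ge> 2"
    and "1 / real n < lam" and "lam < 1 / (real n - 1)"
    and "\<mu> < 0"
    and "ivp_solution n lam \<mu> r"
    and "\<forall>y>\<mu>. r y - y * deriv r y > 0"
  shows "(\<exists>y\<^sub>1 y\<^sub>2. 0 < y\<^sub>1 \<and> y\<^sub>1 < y\<^sub>2 \<and>
            (\<forall>y. \<mu> < y \<and> y < y\<^sub>1 \<longrightarrow> deriv r y > 0) \<and>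
            deriv r y\<^sub>1 = 0 \<and>
            (\<forall>y>y\<^sub>1. deriv r y < 0) \<and>
            (\<forall>y. \<mu> < y \<and> y < y\<^sub>2 \<longrightarrow> deriv (deriv r) y < 0) \<and>
            deriv (deriv r) y\<^sub>2 = 0 \<and>
            (\<forall>y>y\<^sub>2. deriv (deriv r) y > 0)) \<and>
         ((\<lambda>y. y * deriv r y) \<longlongrightarrow> 0) at_top \<and>
         (r \<longlongrightarrow> 0) at_top"
proof -
  interpret profile_curve "real n - 1" "1 / lam" \<mu> r "deriv r" "deriv (deriv r)"
    using profile_curve_of_ivp_solution[OF assms] .
  obtain y1 where y1: "0 < y1" "deriv r y1 = 0"
    and before: "\<And>y. \<mu> < y \<Longrightarrow> y < y1 \<Longrightarrow> 0 < deriv r y"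
    and after: "\<And>y. y1 < y \<Longrightarrow> deriv r y < 0"
    using ex_maximum by blast
  have "\<mu> < y1" using y1 assms(4) by simp
  then obtain y2 where y2: "y1 < y2" "F y2 = 0"
    and conc: "\<And>y. \<mu> < y \<Longrightarrow> y < y2 \<Longrightarrow> F y < 0" and conv: "\<And>y. y2 < y \<Longrightarrow> 0 < F y"
    using ex_inflection[OF _ y1(2) before after] by blast
  have mu: "\<mu> < y" if "y2 \<le> y" for y using that \<open>\<mu> < y1\<close> y2 by simp
  have "0 < y2" "\<And>y. y2 < y \<Longrightarrow> deriv r y < 0" using y1 y2 after by auto
  note lims = limits_at_infinity[OF this conv]
  have "\<forall>y. \<mu> < y \<and> y < y2 \<longrightarrow> deriv (deriv r) y < 0" using conc q_sign(1) by blast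
  moreover have "deriv (deriv r) y2 = 0" using y2 q_sign(2)[OF mu] by simp
  moreover have "\<forall>y>y2. deriv (deriv r) y > 0" using conv q_sign(3) mu by force
  ultimately show ?thesis using y1 y2(1) before after lims by blast
qed

end
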